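(* Assume that $m$-variate stochastic processes $\{\mathbf{V}_{n1}(\varphi),\varphi\in[0,\pi]\}$ and $\{\mathbf{V}_{n2}(\varphi),\varphi\in[0,\pi]\}$ have mean $\mathbf{0}$ and covariance matrix function $\mathbf{B}_n(\varphi_1,\varphi_2)$ for each $n\in\mathbb{N}_0$, and that for all $n\in\mathbb{N}_0$, $\{\mathbf{V}_{n1}(\varphi),\varphi\in[0,\pi]\}$ and $\{\mathbf{V}_{n2}(\varphi),\varphi\in[0,\pi]\}$ are independent. If $\sum_{n=0}^\infty\mathbf{B}_n(\varphi_1,\varphi_2)$ converges, then $$\mathbf{Z}(\varphi,\theta)=\sum_{n=0}^\infty\left(\mathbf{V}_{n1}(\varphi)\cos(n\theta)+\mathbf{V}_{n2}(\varphi)\sin(n\theta)\right),\qquad \varphi\in[0,\pi],\ \theta\in[0,2\pi],$$ is an $m$-variate longitudinally reversible random field on $\mathbb{S}^2$ with mean $\mathbf{0}$ and covariance matrix function $$\mathbf{C}(\varphi_1,\varphi_2,\theta)=\sum_{n=0}^\infty\mathbf{B}_n(\varphi_1,\varphi_2)\cos(n\theta),\qquad \varphi_1,\varphi_2\in[0,\pi],\ \theta\in[-2\pi,2\pi].$$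
   Context: $\mathbb{N}_0$ is the set of nonnegative integers; a prime denotes matrix transpose. $\mathbb{S}^2$ is the unit sphere in $\mathbb{R}^3$; a point of $\mathbb{S}^2$ with longitude $\theta\in[0,2\pi]$ and latitude $\varphi\in[0,\pi]$ is designated $\mathbf{x}=(\varphi,\theta)$, and a random field on $\mathbb{S}^2$ is written in these coordinates as $\{\mathbf{Z}(\varphi,\theta),\varphi\in[0,\pi],\theta\in[0,2\pi]\}$. An $m$-variate real second-order random field on $\mathbb{S}^2$ is axially symmetric if its mean depends only on $\varphi$ and $\mathrm{cov}(\mathbf{Z}(\varphi_1,\theta_1),\mathbf{Z}(\varphi_2,\theta_2))=\mathrm{E}\{(\mathbf{Z}(\mathbf{x}_1)-\mathrm{E}\mathbf{Z}(\mathbf{x}_1))(\mathbf{Z}(\mathbf{x}_2)-\mathrm{E}\mathbf{Z}(\mathbf{x}_2))'\}$, where $\mathbf{x}_k=(\varphi_k,\theta_k)$, depends only on $\varphi_1,\varphi_2,\theta_1-\theta_2$; this is then written $\mathbf{C}(\varphi_1,\varphi_2,\theta_1-\theta_2)$. The field (or its covariance matrix function) is longitudinally reversible if moreover $\mathbf{C}(\varphi_1,\varphi_2,-\theta)=\mathbf{C}(\varphi_1,\varphi_2,\theta)$ for all $\varphi_1,\varphi_2\in[0,\pi]$, $\theta\in[-2\pi,2\pi]$. That $\mathbf{V}_{nk}$ ($k=1,2$) has covariance matrix function $\mathbf{B}_n$ means $\mathbf{B}_n(\varphi_1,\varphi_2)=\mathrm{cov}(\mathbf{V}_{nk}(\varphi_1),\mathbf{V}_{nk}(\varphi_2))$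 for $\varphi_1,\varphi_2\in[0,\pi]$; the $m\times m$ matrices $\mathbf{B}_n(\varphi_1,\varphi_2)$ need not be symmetric. Convergence of $\sum_n\mathbf{B}_n(\varphi_1,\varphi_2)$ is entrywise for all $\varphi_1,\varphi_2\in[0,\pi]$; the random series defining $\mathbf{Z}$ is understood in the mean square sense.
   Formalization: The processes V_nk and V_n'k' are also assumed independent for n ≠ n'; with independence of V_n1 and V_n2 only for each n the claim fails (V_01=V_11=X, V_02=V_12=Y, X,Y iid with variance 1, other terms zero, gives variance 2+2cos θ). *)

theory Defs
  imports "HOL-Probability.Probability"
begin

definition second_order_process ::
  "'w measure \<Rightarrow> 't set \<Rightarrow> ('t \<Rightarrow> 'w \<Rightarrow> real ^ 'm) \<Rightarrow> bool" where
  "second_order_process M T X \<longleftrightarrow>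
     (\<forall>t\<in>T. X t \<in> borel_measurable M \<and> integrable M (\<lambda>\<omega>. (norm (X t \<omega>))\<^sup>2))"

(* The matrix of entrywise expectations of (X - E X)(Y - E Y)'; it is the usual covariance
   only for square integrable X and Y, since non-integrable entries have integral 0. *)
definition cov_mat ::
  "'w measure \<Rightarrow> ('w \<Rightarrow> real ^ 'm) \<Rightarrow> ('w \<Rightarrow> real ^ 'm) \<Rightarrow> real ^ 'm ^ 'm" where
  "cov_mat M X Y =
     (\<chi> i j. \<integral>\<omega>. (X \<omega> - integral\<^sup>L M X) $ i * (Y \<omega> - integral\<^sup>L M Y) $ j \<partial>M)"

(* Independence of the whole processes, as random elements of the product space over T,
   not merely of X s and Y t for each pair of times. *)
definition indep_processes ::
  "'w measure \<Rightarrow> 't set \<Rightarrow> ('t \<Rightarrow> 'w \<Rightarrow> real ^ 'm) \<Rightarrow> ('t \<Rightarrow> 'w \<Rightarrow> real ^ 'm) \<Rightarrow> bool" where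
  "indep_processes M T X Y \<longleftrightarrow>
     prob_space.indep_var M
       (\<Pi>\<^sub>M t\<in>T. borel) (\<lambda>\<omega>. \<lambda>t\<in>T. X t \<omega>)
       (\<Pi>\<^sub>M t\<in>T. borel) (\<lambda>\<omega>. \<lambda>t\<in>T. Y t \<omega>)"

(* The integral is taken in ennreal, so that infinite mean square errors are not read as 0. *)
definition mean_square_sums ::
  "'w measure \<Rightarrow> (nat \<Rightarrow> 'w \<Rightarrow> real ^ 'm) \<Rightarrow> ('w \<Rightarrow> real ^ 'm) \<Rightarrow> bool" where
  "mean_square_sums M f S \<longleftrightarrow>
     S \<in> borel_measurable M \<and>
     (\<lambda>N. \<integral>\<^sup>+\<omega>. ennreal ((norm ((\<Sum>n<N. f n \<omega>) - S \<omega>))\<^sup>2) \<partial>M) \<longlonglongrightarrow> 0"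

(* Points of the sphere are given by (latitude, longitude); as in the coordinate notation
   Z(phi, theta), no identification is made at the poles or along the seam 0 = 2 pi. *)
definition sphere_coords :: "(real \<times> real) set" where
  "sphere_coords = {0..pi} \<times> {0..2 * pi}"

definition axial_cov_fun ::
  "'w measure \<Rightarrow> (real \<times> real \<Rightarrow> 'w \<Rightarrow> real ^ 'm) \<Rightarrow>
     (real \<Rightarrow> real \<Rightarrow> real \<Rightarrow> real ^ 'm ^ 'm) \<Rightarrow> bool" where
  "axial_cov_fun M Z C \<longleftrightarrow>
     (\<forall>\<phi>\<^sub>1\<in>{0..pi}. \<forall>\<phi>\<^sub>2\<in>{0..pi}. \<forall>\<theta>\<^sub>1\<in>{0..2 * pi}. \<forall>\<theta>\<^sub>2\<in>{0..2 * pi}.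
        cov_mat M (Z (\<phi>\<^sub>1, \<theta>\<^sub>1)) (Z (\<phi>\<^sub>2, \<theta>\<^sub>2)) = C \<phi>\<^sub>1 \<phi>\<^sub>2 (\<theta>\<^sub>1 - \<theta>\<^sub>2))"

definition axially_symmetric ::
  "'w measure \<Rightarrow> (real \<times> real \<Rightarrow> 'w \<Rightarrow> real ^ 'm) \<Rightarrow> bool" where
  "axially_symmetric M Z \<longleftrightarrow>
     second_order_process M sphere_coords Z \<and>
     (\<exists>\<mu>. \<forall>(\<phi>, \<theta>)\<in>sphere_coords. integral\<^sup>L M (Z (\<phi>, \<theta>)) = \<mu> \<phi>) \<and>
     (\<exists>C. axial_cov_fun M Z C)"

(* On the arguments concerned, C is determined by Z, because [-2 pi, 2 pi] is exactly the set
   of differences of longitudes. *)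
definition longitudinally_reversible ::
  "'w measure \<Rightarrow> (real \<times> real \<Rightarrow> 'w \<Rightarrow> real ^ 'm) \<Rightarrow> bool" where
  "longitudinally_reversible M Z \<longleftrightarrow>
     axially_symmetric M Z \<and>
     (\<exists>C. axial_cov_fun M Z C \<and>
        (\<forall>\<phi>\<^sub>1\<in>{0..pi}. \<forall>\<phi>\<^sub>2\<in>{0..pi}. \<forall>\<theta>\<in>{-2 * pi..2 * pi}.
           C \<phi>\<^sub>1 \<phi>\<^sub>2 (- \<theta>) = C \<phi>\<^sub>1 \<phi>\<^sub>2 \<theta>))"

definition is_series_field ::
  "'w measure \<Rightarrow> (nat \<Rightarrow> nat \<Rightarrow> real \<Rightarrow> 'w \<Rightarrow> real ^ 'm) \<Rightarrow>
     (real \<times> real \<Rightarrow> 'w \<Rightarrow> real ^ 'm) \<Rightarrow> bool" where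
  "is_series_field M V Z \<longleftrightarrow>
     (\<forall>(\<phi>, \<theta>)\<in>sphere_coords.
        mean_square_sums M
          (\<lambda>n \<omega>. cos (real n * \<theta>) *\<^sub>R V n 1 \<phi> \<omega> + sin (real n * \<theta>) *\<^sub>R V n 2 \<phi> \<omega>)
          (Z (\<phi>, \<theta>)))"

end

theory Submission
  imports Defs
begin

text \<open>
  Independence and centredness make the \<open>V n k\<close> pairwise uncorrelated, so the terms of the series
  are orthogonal in \<open>L\<^sup>2\<close>, and by the addition formula for the cosine the \<open>n\<close>-th terms at two points
  have covariance \<open>cos (n (\<theta>\<^sub>1 - \<theta>\<^sub>2)) B n \<phi>\<^sub>1 \<phi>\<^sub>2\<close>. At a single point the squared norm of a block of
  terms is therefore a block of the convergent series of traces of \<open>B n \<phi> \<phi>\<close>, and the partial sums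
  converge because \<open>L\<^sup>2\<close> is complete. The Cauchy-Schwarz bound of the entries of \<open>B n\<close> by its
  diagonal makes the series of covariances absolutely convergent, and continuity of the \<open>L\<^sup>2\<close> inner
  product carries means and covariances over to the limit.
\<close>

section \<open>Square integrable random elements\<close>

text \<open>The value type is general so that the same notion serves the vector-valued field and its
  real coordinates. Measurability is a separate conjunct, since integrability of the squared norm
  does not imply it.\<close>

definition square_integrable ::
  "'w measure \<Rightarrow> ('w \<Rightarrow> 'a::{banach, second_countable_topology}) \<Rightarrow> bool" where
  "square_integrable M X \<longleftrightarrow> X \<in> borel_measurable M \<and> integrable M (\<lambda>\<omega>. (norm (X \<omega>))\<^sup>2)"

lemma second_order_process_iff:
  "second_order_process M T X \<longleftrightarrow> (\<forall>t\<in>T. square_integrable M (X t))"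
  by (simp add: second_order_process_def square_integrable_def)

lemma square_integrable_measurable [measurable_dest]:
  "square_integrable M X \<Longrightarrow> X \<in> borel_measurable M"
  by (simp add: square_integrable_def)

lemma square_integrable_bound:
  assumes "integrable M g" "X \<in> borel_measurable M" "\<And>\<omega>. (norm (X \<omega>))\<^sup>2 \<le> g \<omega>"
  shows "square_integrable M X"
  unfolding square_integrable_def
proof
  show "integrable M (\<lambda>\<omega>. (norm (X \<omega>))\<^sup>2)"
  proof (rule Bochner_Integration.integrable_bound[OF assms(1)])
    show "AE \<omega> in M. norm ((norm (X \<omega>))\<^sup>2) \<le> norm (g \<omega>)"
      using assms(3) by (intro always_eventually allI) (simp add: abs_le_iff order_trans[OF _ abs_ge_self])
  qed (use assms(2) in measurable)
qed (fact assms(2))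

lemma norm_add_power2_le: "(norm (x + y))\<^sup>2 \<le> 2 * (norm x)\<^sup>2 + 2 * (norm y)\<^sup>2"
  for x y :: "'a::real_normed_vector"
proof -
  have "(norm (x + y))\<^sup>2 \<le> (norm x + norm y)\<^sup>2"
    by (simp add: norm_triangle_ineq power_mono)
  also have "\<dots> \<le> 2 * (norm x)\<^sup>2 + 2 * (norm y)\<^sup>2"
    using zero_le_power2[of "norm x - norm y"] unfolding power2_sum power2_diff by linarith
  finally show ?thesis .
qed

lemma square_integrable_add:
  assumes "square_integrable M X" "square_integrable M Y"
  shows "square_integrable M (\<lambda>\<omega>. X \<omega> + Y \<omega>)"
proof (rule square_integrable_bound)
  show "integrable M (\<lambda>\<omega>. 2 * (norm (X \<omega>))\<^sup>2 + 2 * (norm (Y \<omega>))\<^sup>2)"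
    using assms by (simp add: square_integrable_def)
qed (use assms in \<open>auto simp: square_integrable_def norm_add_power2_le\<close>)

lemma square_integrable_scaleR:
  assumes "square_integrable M X"
  shows "square_integrable M (\<lambda>\<omega>. c *\<^sub>R X \<omega>)"
  using assms by (auto simp: square_integrable_def power_mult_distrib)

lemma square_integrable_diff:
  assumes "square_integrable M X" "square_integrable M Y"
  shows "square_integrable M (\<lambda>\<omega>. X \<omega> - Y \<omega>)"
  using square_integrable_add[OF assms(1) square_integrable_scaleR[OF assms(2), of "-1"]] by simp

lemma square_integrable_sum:
  assumes "\<And>n. n \<in> A \<Longrightarrow> square_integrable M (X n)"
  shows "square_integrable M (\<lambda>\<omega>. \<Sum>n\<in>A. X n \<omega>)"
  using assms
proof (induction A rule: infinite_finite_induct)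
  case (insert x F)
  then show ?case by (simp add: square_integrable_add)
qed (simp_all add: square_integrable_def)

lemma borel_measurable_vec_nth [measurable (raw)]:
  fixes X :: "'w \<Rightarrow> real ^ 'm"
  assumes "X \<in> borel_measurable M"
  shows "(\<lambda>\<omega>. X \<omega> $ i) \<in> borel_measurable M"
  by (rule measurable_compose[OF assms borel_measurable_continuous_onI])
     (intro continuous_intros)

lemma square_integrable_vec_nth:
  fixes X :: "'w \<Rightarrow> real ^ 'm"
  assumes "square_integrable M X"
  shows "square_integrable M (\<lambda>\<omega>. X \<omega> $ i)"
proof (rule square_integrable_bound)
  show "integrable M (\<lambda>\<omega>. (norm (X \<omega>))\<^sup>2)"
    using assms by (simp add: square_integrable_def)
  show "(norm (X \<omega> $ i))\<^sup>2 \<le> (norm (X \<omega>))\<^sup>2" for \<omega>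
    by (intro power_mono Finite_Cartesian_Product.norm_nth_le norm_ge_zero)
qed (use assms in measurable)

lemma square_integrable_mult:
  fixes X Y :: "'w \<Rightarrow> real"
  assumes "square_integrable M X" "square_integrable M Y"
  shows "integrable M (\<lambda>\<omega>. X \<omega> * Y \<omega>)"
proof (rule Bochner_Integration.integrable_bound)
  show "integrable M (\<lambda>\<omega>. (norm (X \<omega>))\<^sup>2 + (norm (Y \<omega>))\<^sup>2)"
    using assms by (simp add: square_integrable_def)
  have "\<bar>x * y\<bar> \<le> x\<^sup>2 + y\<^sup>2" for x y :: real
    using zero_le_power2[of "\<bar>x\<bar> - \<bar>y\<bar>"] zero_le_power2[of x] zero_le_power2[of y]
    unfolding power2_diff abs_mult power2_abs by linarith
  then show "AE \<omega> in M. norm (X \<omega> * Y \<omega>) \<le> norm ((norm (X \<omega>))\<^sup>2 + (norm (Y \<omega>))\<^sup>2)"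
    by simp
qed (use assms in measurable)

section \<open>Cauchy-Schwarz and continuity of the inner product\<close>

text \<open>Transfers the inequality for nonnegative extended integrals. It is applied to the
  absolute values, because \<open>ennreal\<close> would truncate negative values to 0.\<close>

lemma Cauchy_Schwarz_integral:
  fixes X Y :: "'w \<Rightarrow> real"
  assumes X: "square_integrable M X" and Y: "square_integrable M Y"
  shows "\<bar>\<integral>\<omega>. X \<omega> * Y \<omega> \<partial>M\<bar> \<le> sqrt (\<integral>\<omega>. (X \<omega>)\<^sup>2 \<partial>M) * sqrt (\<integral>\<omega>. (Y \<omega>)\<^sup>2 \<partial>M)"
proof -
  have [measurable]: "X \<in> borel_measurable M" "Y \<in> borel_measurable M"
    using X Y by measurable
  have int: "integrable M (\<lambda>\<omega>. (X \<omega>)\<^sup>2)" "integrable M (\<lambda>\<omega>. (Y \<omega>)\<^sup>2)"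
    using X Y by (simp_all add: square_integrable_def)
  have intXY: "integrable M (\<lambda>\<omega>. \<bar>X \<omega>\<bar> * \<bar>Y \<omega>\<bar>)"
    using integrable_norm[OF square_integrable_mult[OF X Y]] by (simp add: abs_mult)
  have "ennreal ((\<integral>\<omega>. \<bar>X \<omega>\<bar> * \<bar>Y \<omega>\<bar> \<partial>M)\<^sup>2) = (\<integral>\<^sup>+\<omega>. ennreal \<bar>X \<omega>\<bar> * ennreal \<bar>Y \<omega>\<bar> \<partial>M)\<^sup>2"
    using nn_integral_eq_integral[OF intXY]
    by (simp add: ennreal_power ennreal_mult)
  also have "\<dots> \<le> (\<integral>\<^sup>+\<omega>. (ennreal \<bar>X \<omega>\<bar>)\<^sup>2 \<partial>M) * (\<integral>\<^sup>+\<omega>. (ennreal \<bar>Y \<omega>\<bar>)\<^sup>2 \<partial>M)"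
    by (rule Cauchy_Schwarz_nn_integral) measurable
  also have "\<dots> = ennreal ((\<integral>\<omega>. (X \<omega>)\<^sup>2 \<partial>M) * (\<integral>\<omega>. (Y \<omega>)\<^sup>2 \<partial>M))"
    using nn_integral_eq_integral[OF int(1)] nn_integral_eq_integral[OF int(2)]
    by (simp add: ennreal_power ennreal_mult)
  finally have "(\<integral>\<omega>. \<bar>X \<omega>\<bar> * \<bar>Y \<omega>\<bar> \<partial>M)\<^sup>2 \<le> (\<integral>\<omega>. (X \<omega>)\<^sup>2 \<partial>M) * (\<integral>\<omega>. (Y \<omega>)\<^sup>2 \<partial>M)"
    by (simp add: ennreal_le_iff)
  then have "(\<integral>\<omega>. \<bar>X \<omega>\<bar> * \<bar>Y \<omega>\<bar> \<partial>M) \<le> sqrt ((\<integral>\<omega>. (X \<omega>)\<^sup>2 \<partial>M) * (\<integral>\<omega>. (Y \<omega>)\<^sup>2 \<partial>M))"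
    by (rule real_le_rsqrt)
  moreover have "\<bar>\<integral>\<omega>. X \<omega> * Y \<omega> \<partial>M\<bar> \<le> (\<integral>\<omega>. \<bar>X \<omega>\<bar> * \<bar>Y \<omega>\<bar> \<partial>M)"
    using integral_norm_bound[of M "\<lambda>\<omega>. X \<omega> * Y \<omega>"] by (simp add: abs_mult)
  ultimately show ?thesis
    by (simp add: real_sqrt_mult)
qed

text \<open>Expanding both factors around their limits leaves the product of the limits and three
  error terms, each containing a factor that tends to 0 in mean square. Cauchy-Schwarz then makes
  every error term vanish.\<close>

lemma tendsto_integral_mult_mean_square:
  fixes X Y :: "'w \<Rightarrow> real"
  assumes sq: "\<And>n. square_integrable M (Xn n)" "\<And>n. square_integrable M (Yn n)"
      "square_integrable M X" "square_integrable M Y"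
    and X: "(\<lambda>n. \<integral>\<omega>. (Xn n \<omega> - X \<omega>)\<^sup>2 \<partial>M) \<longlonglongrightarrow> 0"
    and Y: "(\<lambda>n. \<integral>\<omega>. (Yn n \<omega> - Y \<omega>)\<^sup>2 \<partial>M) \<longlonglongrightarrow> 0"
  shows "(\<lambda>n. \<integral>\<omega>. Xn n \<omega> * Yn n \<omega> \<partial>M) \<longlonglongrightarrow> (\<integral>\<omega>. X \<omega> * Y \<omega> \<partial>M)"
proof -
  \<comment> \<open>One statement for all three error terms: in the mixed ones a factor does not
    depend on \<open>n\<close>, so its second moment is a constant sequence and only the other limit
    is 0.\<close>
  have lim: "(\<lambda>n. \<integral>\<omega>. F n \<omega> * G n \<omega> \<partial>M) \<longlonglongrightarrow> 0"
    if "\<And>n. square_integrable M (F n)" "\<And>n. square_integrable M (G n)"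
      "(\<lambda>n. \<integral>\<omega>. (F n \<omega>)\<^sup>2 \<partial>M) \<longlonglongrightarrow> a" "(\<lambda>n. \<integral>\<omega>. (G n \<omega>)\<^sup>2 \<partial>M) \<longlonglongrightarrow> b" "a * b = 0"
    for F G :: "nat \<Rightarrow> 'w \<Rightarrow> real" and a b :: real
  proof (rule Lim_null_comparison)
    show "\<forall>\<^sub>F n in sequentially. norm (\<integral>\<omega>. F n \<omega> * G n \<omega> \<partial>M)
            \<le> sqrt (\<integral>\<omega>. (F n \<omega>)\<^sup>2 \<partial>M) * sqrt (\<integral>\<omega>. (G n \<omega>)\<^sup>2 \<partial>M)"
      using Cauchy_Schwarz_integral[OF that(1,2)] by simp
    have "(\<lambda>n. sqrt (\<integral>\<omega>. (F n \<omega>)\<^sup>2 \<partial>M) * sqrt (\<integral>\<omega>. (G n \<omega>)\<^sup>2 \<partial>M)) \<longlonglongrightarrow> sqrt a * sqrt b"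
      by (intro tendsto_intros that)
    then show "(\<lambda>n. sqrt (\<integral>\<omega>. (F n \<omega>)\<^sup>2 \<partial>M) * sqrt (\<integral>\<omega>. (G n \<omega>)\<^sup>2 \<partial>M)) \<longlonglongrightarrow> 0"
      using that(5) by (simp flip: real_sqrt_mult)
  qed
  note d = square_integrable_diff[OF sq(1,3)] square_integrable_diff[OF sq(2,4)]
  have "(\<integral>\<omega>. Xn n \<omega> * Yn n \<omega> \<partial>M) = (\<integral>\<omega>. (Xn n \<omega> - X \<omega>) * (Yn n \<omega> - Y \<omega>) \<partial>M)
      + (\<integral>\<omega>. (Xn n \<omega> - X \<omega>) * Y \<omega> \<partial>M) + (\<integral>\<omega>. X \<omega> * (Yn n \<omega> - Y \<omega>) \<partial>M)
      + (\<integral>\<omega>. X \<omega> * Y \<omega> \<partial>M)" for n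
  proof -
    have "(\<integral>\<omega>. Xn n \<omega> * Yn n \<omega> \<partial>M) = (\<integral>\<omega>. (Xn n \<omega> - X \<omega>) * (Yn n \<omega> - Y \<omega>)
        + (Xn n \<omega> - X \<omega>) * Y \<omega> + X \<omega> * (Yn n \<omega> - Y \<omega>) + X \<omega> * Y \<omega> \<partial>M)"
      by (rule Bochner_Integration.integral_cong) (simp_all add: algebra_simps)
    also have "\<dots> = (\<integral>\<omega>. (Xn n \<omega> - X \<omega>) * (Yn n \<omega> - Y \<omega>) \<partial>M)
      + (\<integral>\<omega>. (Xn n \<omega> - X \<omega>) * Y \<omega> \<partial>M) + (\<integral>\<omega>. X \<omega> * (Yn n \<omega> - Y \<omega>) \<partial>M)
      + (\<integral>\<omega>. X \<omega> * Y \<omega> \<partial>M)"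
      by (simp add: square_integrable_mult[OF d(1)[of n] d(2)[of n]]
          square_integrable_mult[OF d(1)[of n] sq(4)] square_integrable_mult[OF sq(3) d(2)[of n]]
          square_integrable_mult[OF sq(3,4)] del: mult_minus_left)
    finally show ?thesis .
  qed
  moreover have "(\<lambda>n. (\<integral>\<omega>. (Xn n \<omega> - X \<omega>) * (Yn n \<omega> - Y \<omega>) \<partial>M)
      + (\<integral>\<omega>. (Xn n \<omega> - X \<omega>) * Y \<omega> \<partial>M) + (\<integral>\<omega>. X \<omega> * (Yn n \<omega> - Y \<omega>) \<partial>M)
      + (\<integral>\<omega>. X \<omega> * Y \<omega> \<partial>M)) \<longlonglongrightarrow> 0 + 0 + 0 + (\<integral>\<omega>. X \<omega> * Y \<omega> \<partial>M)"
    by (intro tendsto_add tendsto_const lim[OF d X Y] lim[OF d(1) sq(4) X tendsto_const]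
        lim[OF sq(3) d(2) tendsto_const Y]) simp_all
  ultimately show ?thesis by simp
qed

section \<open>First moments and completeness of the mean square distance\<close>

lemma (in prob_space) square_integrable_integrable:
  fixes X :: "'a \<Rightarrow> 'b::{banach, second_countable_topology}"
  assumes "square_integrable M X"
  shows "integrable M X"
proof (rule integrable_norm_cancel)
  show "integrable M (\<lambda>\<omega>. norm (X \<omega>))"
  proof (rule square_integrable_imp_integrable)
    show "(\<lambda>\<omega>. norm (X \<omega>)) \<in> borel_measurable M"
      using assms by measurable
  qed (use assms in \<open>simp add: square_integrable_def\<close>)
qed (use assms in measurable)

text \<open>Cauchy-Schwarz against the constant 1, whose second moment is the total mass 1.\<close>

lemma (in prob_space) integral_norm_le_sqrt:
  fixes X :: "'a \<Rightarrow> 'b::{banach, second_countable_topology}"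
  assumes "square_integrable M X"
  shows "(\<integral>\<omega>. norm (X \<omega>) \<partial>M) \<le> sqrt (\<integral>\<omega>. (norm (X \<omega>))\<^sup>2 \<partial>M)"
proof -
  have "square_integrable M (\<lambda>\<omega>. norm (X \<omega>))" "square_integrable M (\<lambda>\<omega>. 1 :: real)"
    using assms by (auto simp: square_integrable_def)
  from Cauchy_Schwarz_integral[OF this] show ?thesis by (simp add: prob_space)
qed

text \<open>The Riesz-Fischer argument: some subsequence converges almost everywhere, and Fatou's
  lemma shows that its pointwise limit is the mean square limit of the whole sequence. The
  conclusion uses the extended integral, so it makes sense before \<open>Y\<close> is known to be
  square integrable.\<close>

lemma (in prob_space) mean_square_complete:
  fixes X :: "nat \<Rightarrow> 'a \<Rightarrow> 'b::{banach, second_countable_topology}"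
  assumes sq: "\<And>n. square_integrable M (X n)"
    and Cauchy: "\<And>e. e > 0 \<Longrightarrow> \<exists>N. \<forall>i\<ge>N. \<forall>j\<ge>N. (\<integral>\<omega>. (norm (X i \<omega> - X j \<omega>))\<^sup>2 \<partial>M) < e"
  shows "\<exists>Y\<in>borel_measurable M. (\<lambda>n. \<integral>\<^sup>+\<omega>. ennreal ((norm (X n \<omega> - Y \<omega>))\<^sup>2) \<partial>M) \<longlonglongrightarrow> 0"
proof -
  have [measurable]: "X n \<in> borel_measurable M" for n
    using sq by measurable
  \<comment> \<open>The almost everywhere Cauchy subsequence is supplied by a theorem about the mean
    of the norm. On a probability space the mean square Cauchy property at \<open>e\<^sup>2\<close>
    gives the one required there at \<open>e\<close>.\<close>
  have L1: "\<exists>N. \<forall>i\<ge>N. \<forall>j\<ge>N. (\<integral>\<omega>. norm (X i \<omega> - X j \<omega>) \<partial>M) < e" if e: "e > 0" for e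
  proof -
    obtain N where N: "(\<integral>\<omega>. (norm (X i \<omega> - X j \<omega>))\<^sup>2 \<partial>M) < e\<^sup>2" if "i \<ge> N" "j \<ge> N" for i j
      using Cauchy[of "e\<^sup>2"] e by auto
    have "(\<integral>\<omega>. norm (X i \<omega> - X j \<omega>) \<partial>M) < e" if "i \<ge> N" "j \<ge> N" for i j
    proof -
      have "sqrt (\<integral>\<omega>. (norm (X i \<omega> - X j \<omega>))\<^sup>2 \<partial>M) < e"
        using real_sqrt_less_mono[OF N[OF that]] e by simp
      then show ?thesis
        using integral_norm_le_sqrt[OF square_integrable_diff[OF sq sq], of i j] by linarith
    qed
    then show ?thesis by blast
  qed
  obtain r where r: "strict_mono r" and ae: "AE \<omega> in M. Cauchy (\<lambda>i. X (r i) \<omega>)"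
    by (rule cauchy_L1_AE_cauchy_subseq[OF square_integrable_integrable[OF sq] L1])
  define Y where "Y = (\<lambda>\<omega>. lim (\<lambda>i. X (r i) \<omega>))"
  have [measurable]: "Y \<in> borel_measurable M"
    unfolding Y_def by (rule borel_measurable_lim_metric) measurable
  have lim: "AE \<omega> in M. (\<lambda>i. X (r i) \<omega>) \<longlonglongrightarrow> Y \<omega>"
    using ae by eventually_elim (simp add: Y_def Cauchy_convergent convergent_LIMSEQ_iff[symmetric])
  \<comment> \<open>With \<open>n\<close> fixed, Fatou's lemma is applied along the subsequence,
    whose indices satisfy \<open>r i \<ge> i\<close> and so eventually exceed
    \<open>N\<close>.\<close>
  have small: "\<exists>N. \<forall>n\<ge>N. (\<integral>\<^sup>+\<omega>. ennreal ((norm (X n \<omega> - Y \<omega>))\<^sup>2) \<partial>M) \<le> ennreal e"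
    if e: "e > 0" for e
  proof -
    obtain N where N: "(\<integral>\<omega>. (norm (X i \<omega> - X j \<omega>))\<^sup>2 \<partial>M) < e" if "i \<ge> N" "j \<ge> N" for i j
      using Cauchy[OF e] by blast
    have "(\<integral>\<^sup>+\<omega>. ennreal ((norm (X n \<omega> - Y \<omega>))\<^sup>2) \<partial>M) \<le> ennreal e" if n: "n \<ge> N" for n
    proof -
      have "(\<integral>\<^sup>+\<omega>. ennreal ((norm (X n \<omega> - Y \<omega>))\<^sup>2) \<partial>M)
          = (\<integral>\<^sup>+\<omega>. liminf (\<lambda>i. ennreal ((norm (X n \<omega> - X (r i) \<omega>))\<^sup>2)) \<partial>M)"
      proof (rule nn_integral_cong_AE)
        show "AE \<omega> in M. ennreal ((norm (X n \<omega> - Y \<omega>))\<^sup>2)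
            = liminf (\<lambda>i. ennreal ((norm (X n \<omega> - X (r i) \<omega>))\<^sup>2))"
          using lim
        proof eventually_elim
          case (elim \<omega>)
          then have "(\<lambda>i. ennreal ((norm (X n \<omega> - X (r i) \<omega>))\<^sup>2))
              \<longlonglongrightarrow> ennreal ((norm (X n \<omega> - Y \<omega>))\<^sup>2)"
            by (intro tendsto_intros)
          then show ?case
            by (intro lim_imp_Liminf[symmetric] sequentially_bot)
        qed
      qed
      also have "\<dots> \<le> liminf (\<lambda>i. \<integral>\<^sup>+\<omega>. ennreal ((norm (X n \<omega> - X (r i) \<omega>))\<^sup>2) \<partial>M)"
        by (rule nn_integral_liminf) measurable
      also have "\<dots> \<le> liminf (\<lambda>i. ennreal e)"
      proof (rule Liminf_mono)
        show "\<forall>\<^sub>F i in sequentially.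
            (\<integral>\<^sup>+\<omega>. ennreal ((norm (X n \<omega> - X (r i) \<omega>))\<^sup>2) \<partial>M) \<le> ennreal e"
          using eventually_ge_at_top[of N]
        proof eventually_elim
          case (elim i)
          then have "r i \<ge> N"
            using seq_suble[OF r, of i] by linarith
          moreover have "integrable M (\<lambda>\<omega>. (norm (X n \<omega> - X (r i) \<omega>))\<^sup>2)"
            using square_integrable_diff[OF sq sq] by (simp add: square_integrable_def)
          ultimately show ?case
            using N[OF n] by (simp add: nn_integral_eq_integral ennreal_leI less_imp_le)
        qed
      qed
      also have "\<dots> = ennreal e"
        by (simp add: Liminf_const)
      finally show ?thesis .
    qed
    then show ?thesis by blast
  qed
  have "(\<lambda>n. \<integral>\<^sup>+\<omega>. ennreal ((norm (X n \<omega> - Y \<omega>))\<^sup>2) \<partial>M) \<longlonglongrightarrow> 0"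
  proof (rule order_tendstoI)
    fix a :: ennreal
    assume "0 < a"
    \<comment> \<open>\<open>a\<close> may be infinite; an intermediate \<open>b\<close> is finite,
      hence the image of a positive real, and turns the weak bound of \<open>small\<close> into a
      strict one.\<close>
    then obtain b where b: "0 < b" "b < a"
      using dense by blast
    then obtain e where e: "b = ennreal e" "e > 0"
      by (cases b) auto
    obtain N where "\<forall>n\<ge>N. (\<integral>\<^sup>+\<omega>. ennreal ((norm (X n \<omega> - Y \<omega>))\<^sup>2) \<partial>M) \<le> b"
      using small[OF e(2)] e(1) by blast
    then show "\<forall>\<^sub>F n in sequentially. (\<integral>\<^sup>+\<omega>. ennreal ((norm (X n \<omega> - Y \<omega>))\<^sup>2) \<partial>M) < a"
      using b(2) by (auto simp: eventually_sequentially intro: le_less_trans)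
  qed simp
  then show ?thesis
    by (intro bexI[of _ Y]) simp_all
qed

section \<open>Coordinates of vectors and of mean square sums\<close>

lemma integral_vec_nth:
  fixes X :: "'w \<Rightarrow> real ^ 'm"
  assumes "integrable M X"
  shows "(\<integral>\<omega>. X \<omega> $ i \<partial>M) = integral\<^sup>L M X $ i"
  by (rule integral_bounded_linear[OF bounded_linear_vec_nth assms])

lemma norm_vec_power2: "(norm x)\<^sup>2 = (\<Sum>i\<in>UNIV. (x $ i)\<^sup>2)" for x :: "real ^ 'm"
  unfolding power2_norm_eq_inner inner_vec_def by (simp add: power2_eq_square)

text \<open>Convergence of finite vectors is coordinatewise. The entry type is general so that two
  applications reduce a series of matrices to its scalar entries.\<close>

lemma summable_vec:
  fixes f :: "nat \<Rightarrow> 'a::real_normed_vector ^ 'm"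
  assumes "\<And>i. summable (\<lambda>n. f n $ i)"
  shows "summable f"
proof (rule sums_summable)
  show "f sums (\<chi> i. \<Sum>n. f n $ i)"
    unfolding sums_def
    by (rule vec_tendstoI) (use assms in \<open>simp add: sum_component summable_LIMSEQ\<close>)
qed

text \<open>Some partial sum lies at finite mean square distance from \<open>S\<close>. Subtracting
  this square integrable difference from the square integrable partial sum leaves
  \<open>S\<close>.\<close>

lemma mean_square_sums_square_integrable:
  assumes f: "\<And>n. square_integrable M (f n)" and S: "mean_square_sums M f S"
  shows "square_integrable M S"
proof -
  note [measurable] = square_integrable_measurable[OF f]
  have [measurable]: "S \<in> borel_measurable M"
    using S by (simp add: mean_square_sums_def)
  have "\<forall>\<^sub>F N in sequentially.
      (\<integral>\<^sup>+\<omega>. ennreal ((norm ((\<Sum>n<N. f n \<omega>) - S \<omega>))\<^sup>2) \<partial>M) < 1"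
    using S unfolding mean_square_sums_def by (intro order_tendstoD(2)[of _ 0]) auto
  then obtain N where N: "(\<integral>\<^sup>+\<omega>. ennreal ((norm ((\<Sum>n<N. f n \<omega>) - S \<omega>))\<^sup>2) \<partial>M) < 1"
    by (auto simp: eventually_sequentially)
  have "square_integrable M (\<lambda>\<omega>. (\<Sum>n<N. f n \<omega>) - S \<omega>)"
    unfolding square_integrable_def
  proof
    show "integrable M (\<lambda>\<omega>. (norm ((\<Sum>n<N. f n \<omega>) - S \<omega>))\<^sup>2)"
      unfolding integrable_iff_bounded
      using N by (auto intro: less_trans[OF _ ennreal_one_less_top])
  qed measurable
  from square_integrable_diff[OF square_integrable_sum[where A = "{..<N}" and X = f, OF f] this] show ?thesis
    by simp
qed

text \<open>A coordinate is bounded by the norm, so its error is squeezed to 0. Since the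
  differences are square integrable, the extended integral in the definition may be replaced by the
  ordinary one.\<close>

lemma mean_square_sums_vec_nth:
  assumes f: "\<And>n. square_integrable M (f n)" and S: "mean_square_sums M f S"
  shows "(\<lambda>N. \<integral>\<omega>. ((\<Sum>n<N. f n \<omega> $ i) - S \<omega> $ i)\<^sup>2 \<partial>M) \<longlonglongrightarrow> 0"
proof (rule real_tendsto_sandwich[OF _ _ tendsto_const])
  have d: "square_integrable M (\<lambda>\<omega>. (\<Sum>n<N. f n \<omega>) - S \<omega>)" for N
    by (intro square_integrable_diff square_integrable_sum f mean_square_sums_square_integrable[OF f S])
  have "(\<integral>\<^sup>+\<omega>. ennreal ((norm ((\<Sum>n<N. f n \<omega>) - S \<omega>))\<^sup>2) \<partial>M)
      = ennreal (\<integral>\<omega>. (norm ((\<Sum>n<N. f n \<omega>) - S \<omega>))\<^sup>2 \<partial>M)" for N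
    using d by (intro nn_integral_eq_integral) (auto simp: square_integrable_def)
  then show "(\<lambda>N. \<integral>\<omega>. (norm ((\<Sum>n<N. f n \<omega>) - S \<omega>))\<^sup>2 \<partial>M) \<longlonglongrightarrow> 0"
    using S by (simp add: mean_square_sums_def ennreal_tendsto_0_iff)
  show "\<forall>\<^sub>F N in sequentially. (\<integral>\<omega>. ((\<Sum>n<N. f n \<omega> $ i) - S \<omega> $ i)\<^sup>2 \<partial>M)
      \<le> (\<integral>\<omega>. (norm ((\<Sum>n<N. f n \<omega>) - S \<omega>))\<^sup>2 \<partial>M)"
  proof (intro always_eventually allI integral_mono)
    fix N
    show "integrable M (\<lambda>\<omega>. ((\<Sum>n<N. f n \<omega> $ i) - S \<omega> $ i)\<^sup>2)"
      using square_integrable_vec_nth[OF d, of N i] by (simp add: square_integrable_def sum_component)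
    show "integrable M (\<lambda>\<omega>. (norm ((\<Sum>n<N. f n \<omega>) - S \<omega>))\<^sup>2)"
      using d by (simp add: square_integrable_def)
    fix \<omega>
    have "(norm (((\<Sum>n<N. f n \<omega>) - S \<omega>) $ i))\<^sup>2 \<le> (norm ((\<Sum>n<N. f n \<omega>) - S \<omega>))\<^sup>2"
      by (intro power_mono Finite_Cartesian_Product.norm_nth_le norm_ge_zero)
    then show "((\<Sum>n<N. f n \<omega> $ i) - S \<omega> $ i)\<^sup>2 \<le> (norm ((\<Sum>n<N. f n \<omega>) - S \<omega>))\<^sup>2"
      by (simp add: sum_component)
  qed
qed simp_all

section \<open>From independent processes to orthogonal terms\<close>

text \<open>Evaluating a path at one time and one coordinate is measurable on the product space, so
  independence passes to two scalar variables. The expectation of their product factors, and the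
  first factor is 0.\<close>

lemma (in prob_space) indep_processes_uncorrelated:
  fixes X Y :: "'t \<Rightarrow> 'a \<Rightarrow> real ^ 'm"
  assumes indep: "indep_processes M T X Y" and st: "s \<in> T" "t \<in> T"
    and X: "square_integrable M (X s)" and Y: "square_integrable M (Y t)"
    and mean: "integral\<^sup>L M (X s) = 0"
  shows "(\<integral>\<omega>. X s \<omega> $ i * Y t \<omega> $ j \<partial>M) = 0"
proof -
  note XY = square_integrable_integrable[OF square_integrable_vec_nth[OF X]]
    square_integrable_integrable[OF square_integrable_vec_nth[OF Y]]
  have "indep_var borel ((\<lambda>x. x s $ i) \<circ> (\<lambda>\<omega>. \<lambda>t\<in>T. X t \<omega>))
      borel ((\<lambda>x. x t $ j) \<circ> (\<lambda>\<omega>. \<lambda>t\<in>T. Y t \<omega>))"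
  proof (rule indep_var_compose[OF indep[unfolded indep_processes_def]])
    show "(\<lambda>x. (x s :: real ^ 'm) $ i) \<in> (\<Pi>\<^sub>M t\<in>T. borel) \<rightarrow>\<^sub>M borel"
      using st by measurable
    show "(\<lambda>x. (x t :: real ^ 'm) $ j) \<in> (\<Pi>\<^sub>M t\<in>T. borel) \<rightarrow>\<^sub>M borel"
      using st by measurable
  qed
  then have "indep_var borel (\<lambda>\<omega>. X s \<omega> $ i) borel (\<lambda>\<omega>. Y t \<omega> $ j)"
    using st by (simp add: comp_def)
  from indep_var_lebesgue_integral[OF this XY] show ?thesis
    by (simp add: integral_vec_nth[OF square_integrable_integrable[OF X]] mean)
qed

text \<open>Independence is required between the two processes of one degree and between any two
  processes of different degrees. The first removes mixed sine-cosine moments, the second the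
  moments between different terms of the series.\<close>

locale spectral_processes = prob_space M
  for M :: "'w measure" +
  fixes V :: "nat \<Rightarrow> nat \<Rightarrow> real \<Rightarrow> 'w \<Rightarrow> real ^ 'm"
    and B :: "nat \<Rightarrow> real \<Rightarrow> real \<Rightarrow> real ^ 'm ^ 'm"
  assumes square_integrable_V:
      "k \<in> {1, 2} \<Longrightarrow> \<phi> \<in> {0..pi} \<Longrightarrow> square_integrable M (V n k \<phi>)"
    and mean_V: "k \<in> {1, 2} \<Longrightarrow> \<phi> \<in> {0..pi} \<Longrightarrow> integral\<^sup>L M (V n k \<phi>) = 0"
    and cov_V: "k \<in> {1, 2} \<Longrightarrow> \<phi>\<^sub>1 \<in> {0..pi} \<Longrightarrow> \<phi>\<^sub>2 \<in> {0..pi} \<Longrightarrow>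
      cov_mat M (V n k \<phi>\<^sub>1) (V n k \<phi>\<^sub>2) = B n \<phi>\<^sub>1 \<phi>\<^sub>2"
    and indep_V: "indep_processes M {0..pi} (V n 1) (V n 2)"
    and indep_V_degrees: "n \<noteq> n' \<Longrightarrow> k \<in> {1, 2} \<Longrightarrow> k' \<in> {1, 2} \<Longrightarrow>
      indep_processes M {0..pi} (V n k) (V n' k')"
    and summable_B: "\<phi>\<^sub>1 \<in> {0..pi} \<Longrightarrow> \<phi>\<^sub>2 \<in> {0..pi} \<Longrightarrow> summable (\<lambda>n. B n \<phi>\<^sub>1 \<phi>\<^sub>2)"
begin

lemma integral_V_mult:
  assumes k: "k \<in> {1, 2}" "k' \<in> {1, 2}" and \<phi>: "\<phi>\<^sub>1 \<in> {0..pi}" "\<phi>\<^sub>2 \<in> {0..pi}"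
  shows "(\<integral>\<omega>. V n k \<phi>\<^sub>1 \<omega> $ i * V n' k' \<phi>\<^sub>2 \<omega> $ j \<partial>M)
    = (if n = n' \<and> k = k' then B n \<phi>\<^sub>1 \<phi>\<^sub>2 $ i $ j else 0)"
proof -
  note uncorrelated = indep_processes_uncorrelated
    [OF _ _ _ square_integrable_V square_integrable_V mean_V]
  consider "n = n'" "k = k'" | "n \<noteq> n'" | "n = n'" "k = 1" "k' = 2" | "n = n'" "k = 2" "k' = 1"
    using k by auto
  then show ?thesis
  proof cases
    case 1
    have "B n \<phi>\<^sub>1 \<phi>\<^sub>2 $ i $ j = cov_mat M (V n k \<phi>\<^sub>1) (V n k \<phi>\<^sub>2) $ i $ j"
      using cov_V[OF k(1) \<phi>] by simp
    also have "\<dots> = (\<integral>\<omega>. V n k \<phi>\<^sub>1 \<omega> $ i * V n k \<phi>\<^sub>2 \<omega> $ j \<partial>M)"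
      by (simp add: cov_mat_def mean_V[OF k(1) \<phi>(1)] mean_V[OF k(1) \<phi>(2)])
    finally show ?thesis using 1 by simp
  next
    case 2
    then show ?thesis using uncorrelated[OF indep_V_degrees[OF 2 k] \<phi> k(1) \<phi>(1) k(2) \<phi>(2) k(1) \<phi>(1)] by simp
  next
    case 3
    then show ?thesis using uncorrelated[OF indep_V \<phi> _ \<phi>(1) _ \<phi>(2) _ \<phi>(1)] by simp
  next
    \<comment> \<open>\<open>indep_V\<close> fixes the order of the two processes, so the factors,
      points and coordinates are exchanged.\<close>
    case 4
    then show ?thesis
      using uncorrelated[OF indep_V \<phi>(2,1) _ \<phi>(2) _ \<phi>(1) _ \<phi>(2), where i = j and j = i] by (simp add: mult.commute)
  qed
qed

definition harmonic :: "nat \<Rightarrow> real \<Rightarrow> real \<Rightarrow> 'w \<Rightarrow> real ^ 'm" where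
  "harmonic n \<phi> \<theta> \<omega> = cos (real n * \<theta>) *\<^sub>R V n 1 \<phi> \<omega> + sin (real n * \<theta>) *\<^sub>R V n 2 \<phi> \<omega>"

lemma square_integrable_harmonic:
  "\<phi> \<in> {0..pi} \<Longrightarrow> square_integrable M (harmonic n \<phi> \<theta>)"
  unfolding harmonic_def
  by (intro square_integrable_add square_integrable_scaleR square_integrable_V) auto

lemma integral_harmonic:
  assumes "\<phi> \<in> {0..pi}"
  shows "integral\<^sup>L M (harmonic n \<phi> \<theta>) = 0"
proof -
  have "integrable M (V n 1 \<phi>)" "integrable M (V n 2 \<phi>)"
    by (auto intro!: square_integrable_integrable square_integrable_V assms)
  then show ?thesis
    using assms by (simp add: harmonic_def[abs_def] mean_V del: One_nat_def)
qed

text \<open>The cosine and sine processes of one degree share the covariance \<open>B n\<close>, so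
  the products of cosines and of sines carry the same factor and combine by the addition formula.
  All other moments vanish.\<close>

lemma integral_harmonic_mult:
  assumes \<phi>: "\<phi>\<^sub>1 \<in> {0..pi}" "\<phi>\<^sub>2 \<in> {0..pi}"
  shows "(\<integral>\<omega>. harmonic n \<phi>\<^sub>1 \<theta>\<^sub>1 \<omega> $ i * harmonic n' \<phi>\<^sub>2 \<theta>\<^sub>2 \<omega> $ j \<partial>M)
    = (if n = n' then cos (real n * (\<theta>\<^sub>1 - \<theta>\<^sub>2)) * B n \<phi>\<^sub>1 \<phi>\<^sub>2 $ i $ j else 0)"
proof -
  let ?P = "\<lambda>k k' \<omega>. V n k \<phi>\<^sub>1 \<omega> $ i * V n' k' \<phi>\<^sub>2 \<omega> $ j"
  let ?c = "cos (real n * \<theta>\<^sub>1)" and ?s = "sin (real n * \<theta>\<^sub>1)"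
  let ?c' = "cos (real n' * \<theta>\<^sub>2)" and ?s' = "sin (real n' * \<theta>\<^sub>2)"
  have int: "integrable M (?P k k')" if "k \<in> {1, 2}" "k' \<in> {1, 2}" for k k'
    using that \<phi> by (intro square_integrable_mult square_integrable_vec_nth square_integrable_V)
  have "(\<integral>\<omega>. harmonic n \<phi>\<^sub>1 \<theta>\<^sub>1 \<omega> $ i * harmonic n' \<phi>\<^sub>2 \<theta>\<^sub>2 \<omega> $ j \<partial>M)
      = (\<integral>\<omega>. (?c * ?c') * ?P 1 1 \<omega> + (?c * ?s') * ?P 1 2 \<omega>
          + (?s * ?c') * ?P 2 1 \<omega> + (?s * ?s') * ?P 2 2 \<omega> \<partial>M)"
    by (rule Bochner_Integration.integral_cong) (simp_all add: harmonic_def algebra_simps)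
  also have "\<dots> = (?c * ?c') * integral\<^sup>L M (?P 1 1) + (?c * ?s') * integral\<^sup>L M (?P 1 2)
          + (?s * ?c') * integral\<^sup>L M (?P 2 1) + (?s * ?s') * integral\<^sup>L M (?P 2 2)"
    using int[of 1 1] int[of 1 2] int[of 2 1] int[of 2 2] by simp
  also have "\<dots> = (if n = n' then (?c * ?c' + ?s * ?s') * B n \<phi>\<^sub>1 \<phi>\<^sub>2 $ i $ j else 0)"
    using \<phi> by (simp add: integral_V_mult algebra_simps)
  finally show ?thesis
    by (simp add: cos_diff right_diff_distrib)
qed

text \<open>Orthogonality collapses the double sum to its diagonal. An arbitrary finite index set
  covers both the partial sums and the blocks between two partial sums.\<close>

lemma integral_sum_harmonic_mult:
  assumes \<phi>: "\<phi>\<^sub>1 \<in> {0..pi}" "\<phi>\<^sub>2 \<in> {0..pi}" and "finite A"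
  shows "(\<integral>\<omega>. (\<Sum>n\<in>A. harmonic n \<phi>\<^sub>1 \<theta>\<^sub>1 \<omega> $ i) * (\<Sum>n\<in>A. harmonic n \<phi>\<^sub>2 \<theta>\<^sub>2 \<omega> $ j) \<partial>M)
    = (\<Sum>n\<in>A. cos (real n * (\<theta>\<^sub>1 - \<theta>\<^sub>2)) * B n \<phi>\<^sub>1 \<phi>\<^sub>2 $ i $ j)"
proof -
  have int: "integrable M (\<lambda>\<omega>. harmonic n \<phi>\<^sub>1 \<theta>\<^sub>1 \<omega> $ i * harmonic n' \<phi>\<^sub>2 \<theta>\<^sub>2 \<omega> $ j)" for n n'
    using \<phi> by (intro square_integrable_mult square_integrable_vec_nth square_integrable_harmonic)
  show ?thesis
    using \<open>finite A\<close> by (simp add: sum_product int integral_harmonic_mult[OF \<phi>])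
qed

section \<open>Convergence of the covariance series and of the random series\<close>

text \<open>Cauchy-Schwarz followed by the inequality of arithmetic and geometric means. A sum of
  diagonal entries is used as the bound because the corresponding series are known to
  converge.\<close>

lemma abs_B_le:
  assumes \<phi>: "\<phi>\<^sub>1 \<in> {0..pi}" "\<phi>\<^sub>2 \<in> {0..pi}"
  shows "\<bar>B n \<phi>\<^sub>1 \<phi>\<^sub>2 $ i $ j\<bar> \<le> B n \<phi>\<^sub>1 \<phi>\<^sub>1 $ i $ i + B n \<phi>\<^sub>2 \<phi>\<^sub>2 $ j $ j"
proof -
  let ?X = "\<lambda>\<omega>. V n 1 \<phi>\<^sub>1 \<omega> $ i" and ?Y = "\<lambda>\<omega>. V n 1 \<phi>\<^sub>2 \<omega> $ j"
  have sq: "square_integrable M ?X" "square_integrable M ?Y"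
    using \<phi> by (auto intro!: square_integrable_vec_nth square_integrable_V)
  have B: "(\<integral>\<omega>. (?X \<omega>)\<^sup>2 \<partial>M) = B n \<phi>\<^sub>1 \<phi>\<^sub>1 $ i $ i" "(\<integral>\<omega>. (?Y \<omega>)\<^sup>2 \<partial>M) = B n \<phi>\<^sub>2 \<phi>\<^sub>2 $ j $ j"
    using \<phi> by (simp_all add: power2_eq_square integral_V_mult)
  have nonneg: "B n \<phi>\<^sub>1 \<phi>\<^sub>1 $ i $ i \<ge> 0" "B n \<phi>\<^sub>2 \<phi>\<^sub>2 $ j $ j \<ge> 0"
    unfolding B[symmetric] by simp_all
  have "\<bar>B n \<phi>\<^sub>1 \<phi>\<^sub>2 $ i $ j\<bar> \<le> sqrt (B n \<phi>\<^sub>1 \<phi>\<^sub>1 $ i $ i * B n \<phi>\<^sub>2 \<phi>\<^sub>2 $ j $ j)"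
    using Cauchy_Schwarz_integral[OF sq] \<phi> by (simp add: B integral_V_mult real_sqrt_mult del: One_nat_def)
  also have "\<dots> \<le> (B n \<phi>\<^sub>1 \<phi>\<^sub>1 $ i $ i + B n \<phi>\<^sub>2 \<phi>\<^sub>2 $ j $ j) / 2"
    by (rule arith_geo_mean_sqrt[OF nonneg])
  also have "\<dots> \<le> B n \<phi>\<^sub>1 \<phi>\<^sub>1 $ i $ i + B n \<phi>\<^sub>2 \<phi>\<^sub>2 $ j $ j"
    using nonneg by simp
  finally show ?thesis .
qed

lemma summable_B_nth:
  "\<phi>\<^sub>1 \<in> {0..pi} \<Longrightarrow> \<phi>\<^sub>2 \<in> {0..pi} \<Longrightarrow> summable (\<lambda>n. B n \<phi>\<^sub>1 \<phi>\<^sub>2 $ i $ j)"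
  by (intro bounded_linear.summable[OF bounded_linear_vec_nth] summable_B)

text \<open>Multiplying by cosines could destroy a merely conditional convergence. The diagonal
  series at the two latitudes give a convergent majorant that does not depend on
  \<open>\<theta>\<close>.\<close>

lemma summable_cos_B:
  assumes \<phi>: "\<phi>\<^sub>1 \<in> {0..pi}" "\<phi>\<^sub>2 \<in> {0..pi}"
  shows "summable (\<lambda>n. cos (real n * \<theta>) *\<^sub>R B n \<phi>\<^sub>1 \<phi>\<^sub>2)"
proof (intro summable_vec)
  fix i j
  show "summable (\<lambda>n. (cos (real n * \<theta>) *\<^sub>R B n \<phi>\<^sub>1 \<phi>\<^sub>2) $ i $ j)"
  proof (rule summable_comparison_test')
    show "summable (\<lambda>n. B n \<phi>\<^sub>1 \<phi>\<^sub>1 $ i $ i + B n \<phi>\<^sub>2 \<phi>\<^sub>2 $ j $ j)"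
      using \<phi> by (intro summable_add summable_B_nth)
    fix n
    have "\<bar>cos (real n * \<theta>)\<bar> * \<bar>B n \<phi>\<^sub>1 \<phi>\<^sub>2 $ i $ j\<bar> \<le> 1 * \<bar>B n \<phi>\<^sub>1 \<phi>\<^sub>2 $ i $ j\<bar>"
      by (intro mult_right_mono) simp_all
    then show "norm ((cos (real n * \<theta>) *\<^sub>R B n \<phi>\<^sub>1 \<phi>\<^sub>2) $ i $ j)
        \<le> B n \<phi>\<^sub>1 \<phi>\<^sub>1 $ i $ i + B n \<phi>\<^sub>2 \<phi>\<^sub>2 $ j $ j"
      using abs_B_le[OF \<phi>, of n i j] by (simp add: abs_mult)
  qed
qed

definition cov_series :: "real \<Rightarrow> real \<Rightarrow> real \<Rightarrow> real ^ 'm ^ 'm" where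
  "cov_series \<phi>\<^sub>1 \<phi>\<^sub>2 \<theta> = (\<Sum>n. cos (real n * \<theta>) *\<^sub>R B n \<phi>\<^sub>1 \<phi>\<^sub>2)"

lemma cov_series_nth_sums:
  assumes "\<phi>\<^sub>1 \<in> {0..pi}" "\<phi>\<^sub>2 \<in> {0..pi}"
  shows "(\<lambda>n. cos (real n * \<theta>) * B n \<phi>\<^sub>1 \<phi>\<^sub>2 $ i $ j) sums (cov_series \<phi>\<^sub>1 \<phi>\<^sub>2 \<theta> $ i $ j)"
  using bounded_linear.sums[OF bounded_linear_vec_nth[of j] bounded_linear.sums
      [OF bounded_linear_vec_nth[of i] summable_sums[OF summable_cos_B[OF assms, of \<theta>]]]]
  by (simp add: cov_series_def)

lemma ex_mean_square_sums:
  assumes \<phi>: "\<phi> \<in> {0..pi}"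
  shows "\<exists>S. mean_square_sums M (\<lambda>n. harmonic n \<phi> \<theta>) S"
proof -
  let ?S = "\<lambda>N \<omega>. \<Sum>n<N. harmonic n \<phi> \<theta> \<omega>"
  \<comment> \<open>The trace of \<open>B n \<phi> \<phi>\<close> is the squared mean square norm of
    the \<open>n\<close>-th term. It does not involve \<open>\<theta>\<close>, since at coinciding
    points the cosine factor is \<open>cos 0 = 1\<close>.\<close>
  define b where "b n = (\<Sum>i\<in>UNIV. B n \<phi> \<phi> $ i $ i)" for n
  have sq: "square_integrable M (?S N)" for N
    by (intro square_integrable_sum square_integrable_harmonic \<phi>)
  \<comment> \<open>Pythagoras for the orthogonal terms of a block, computed coordinate by
    coordinate.\<close>
  have dist: "(\<integral>\<omega>. (norm (?S l \<omega> - ?S k \<omega>))\<^sup>2 \<partial>M) = sum b {k..<l}" if "k \<le> l" for k l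
  proof -
    have int: "integrable M (\<lambda>\<omega>. (\<Sum>n=k..<l. harmonic n \<phi> \<theta> \<omega> $ i)
        * (\<Sum>n=k..<l. harmonic n \<phi> \<theta> \<omega> $ i))" for i
      by (intro square_integrable_mult square_integrable_sum square_integrable_vec_nth
          square_integrable_harmonic \<phi>)
    have "?S l \<omega> - ?S k \<omega> = (\<Sum>n=k..<l. harmonic n \<phi> \<theta> \<omega>)" for \<omega>
      using sum_diff_nat_ivl[of 0 k l "\<lambda>n. harmonic n \<phi> \<theta> \<omega>"] that by (simp add: atLeast0LessThan)
    then have "(\<integral>\<omega>. (norm (?S l \<omega> - ?S k \<omega>))\<^sup>2 \<partial>M) =
        (\<integral>\<omega>. (\<Sum>i\<in>UNIV. (\<Sum>n=k..<l. harmonic n \<phi> \<theta> \<omega> $ i)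
          * (\<Sum>n=k..<l. harmonic n \<phi> \<theta> \<omega> $ i)) \<partial>M)"
      by (simp only: norm_vec_power2) (simp add: sum_component power2_eq_square)
    also have "\<dots> = (\<Sum>i\<in>UNIV. \<Sum>n=k..<l. B n \<phi> \<phi> $ i $ i)"
      by (simp add: Bochner_Integration.integral_sum[OF int] integral_sum_harmonic_mult[OF \<phi> \<phi>])
    also have "\<dots> = sum b {k..<l}"
      unfolding b_def by (rule sum.swap)
    finally show ?thesis .
  qed
  have "summable b"
    unfolding b_def using \<phi> by (intro summable_sum summable_B_nth)
  have "\<exists>N. \<forall>k\<ge>N. \<forall>l\<ge>N. (\<integral>\<omega>. (norm (?S k \<omega> - ?S l \<omega>))\<^sup>2 \<partial>M) < e" if e: "e > 0" for e
  proof -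
    obtain N where N: "norm (sum b {m..<n}) < e" if "m \<ge> N" for m n
      using \<open>summable b\<close> e unfolding summable_Cauchy by blast
    have less: "(\<integral>\<omega>. (norm (?S l \<omega> - ?S k \<omega>))\<^sup>2 \<partial>M) < e" if "k \<ge> N" "k \<le> l" for k l
      using N[of k l] that by (simp add: dist)
    have "(\<integral>\<omega>. (norm (?S k \<omega> - ?S l \<omega>))\<^sup>2 \<partial>M) < e" if "k \<ge> N" "l \<ge> N" for k l
    proof (cases "k \<le> l")
      case True
      with less[of k l] that show ?thesis by (simp add: norm_minus_commute)
    next
      case False
      with less[of l k] that show ?thesis by simp
    qed
    then show ?thesis by blast
  qed
  from mean_square_complete[OF sq this] show ?thesis
    unfolding mean_square_sums_def by blast
qed

lemma ex_series_field: "\<exists>Z. is_series_field M V Z"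
proof
  \<comment> \<open>Mean square limits are determined only almost surely, so one is chosen
    separately at each point.\<close>
  let ?Z = "\<lambda>(\<phi>, \<theta>). SOME S. mean_square_sums M (\<lambda>n. harmonic n \<phi> \<theta>) S"
  show "is_series_field M V ?Z"
    unfolding is_series_field_def sphere_coords_def
    using someI_ex[OF ex_mean_square_sums] by (auto simp: harmonic_def[abs_def])
qed

section \<open>Mean and covariance of an arbitrary version of the series field\<close>

context
  fixes Z :: "real \<times> real \<Rightarrow> 'w \<Rightarrow> real ^ 'm"
  assumes Z: "is_series_field M V Z"
begin

lemma series_field_sums:
  "(\<phi>, \<theta>) \<in> sphere_coords \<Longrightarrow> mean_square_sums M (\<lambda>n. harmonic n \<phi> \<theta>) (Z (\<phi>, \<theta>))"
  using Z unfolding is_series_field_def harmonic_def[abs_def] by blast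

lemma square_integrable_series_field:
  assumes "(\<phi>, \<theta>) \<in> sphere_coords"
  shows "square_integrable M (Z (\<phi>, \<theta>))"
  using assms mean_square_sums_square_integrable[OF square_integrable_harmonic series_field_sums]
  by (auto simp: sphere_coords_def)

text \<open>Pairing with the constant 1 turns continuity of the inner product into continuity of the
  mean, and every partial sum has mean 0.\<close>

lemma integral_series_field:
  assumes p: "(\<phi>, \<theta>) \<in> sphere_coords"
  shows "integral\<^sup>L M (Z (\<phi>, \<theta>)) = 0"
proof -
  have \<phi>: "\<phi> \<in> {0..pi}" using p by (simp add: sphere_coords_def)
  have "(\<integral>\<omega>. Z (\<phi>, \<theta>) \<omega> $ i \<partial>M) = 0" for i
  proof -
    have one: "square_integrable M (\<lambda>\<omega>. 1 :: real)"
      by (simp add: square_integrable_def)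
    have "(\<lambda>N. \<integral>\<omega>. (\<Sum>n<N. harmonic n \<phi> \<theta> \<omega> $ i) * 1 \<partial>M) \<longlonglongrightarrow> (\<integral>\<omega>. Z (\<phi>, \<theta>) \<omega> $ i * 1 \<partial>M)"
      by (intro tendsto_integral_mult_mean_square square_integrable_sum square_integrable_vec_nth
          square_integrable_harmonic square_integrable_series_field one
          mean_square_sums_vec_nth series_field_sums p \<phi>) simp
    moreover have "(\<integral>\<omega>. (\<Sum>n<N. harmonic n \<phi> \<theta> \<omega> $ i) \<partial>M) = 0" for N
    proof -
      have "integrable M (harmonic n \<phi> \<theta>)" for n
        using \<phi> by (intro square_integrable_integrable square_integrable_harmonic)
      then have "(\<integral>\<omega>. harmonic n \<phi> \<theta> \<omega> $ i \<partial>M) = 0" "integrable M (\<lambda>\<omega>. harmonic n \<phi> \<theta> \<omega> $ i)" for n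
        using \<phi> by (simp_all add: integral_vec_nth integral_harmonic square_integrable_integrable
            square_integrable_vec_nth square_integrable_harmonic)
      then show ?thesis by simp
    qed
    ultimately show ?thesis
      by (simp add: LIMSEQ_const_iff)
  qed
  then show ?thesis
    using integral_vec_nth[OF square_integrable_integrable[OF square_integrable_series_field[OF p]]]
    by (simp add: vec_eq_iff)
qed

text \<open>The product moments of the partial sums have two limits that must agree: the moment of
  the limits, by continuity of the inner product, and the entry of the covariance series, by
  orthogonality. As \<open>Z\<close> has mean 0, these moments are its covariances.\<close>

lemma axial_cov_fun_series_field: "axial_cov_fun M Z cov_series"
  unfolding axial_cov_fun_def
proof (intro ballI)
  fix \<phi>\<^sub>1 \<phi>\<^sub>2 \<theta>\<^sub>1 \<theta>\<^sub>2 :: real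
  assume \<phi>: "\<phi>\<^sub>1 \<in> {0..pi}" "\<phi>\<^sub>2 \<in> {0..pi}" and \<theta>: "\<theta>\<^sub>1 \<in> {0..2 * pi}" "\<theta>\<^sub>2 \<in> {0..2 * pi}"
  have p: "(\<phi>\<^sub>1, \<theta>\<^sub>1) \<in> sphere_coords" "(\<phi>\<^sub>2, \<theta>\<^sub>2) \<in> sphere_coords"
    using \<phi> \<theta> by (simp_all add: sphere_coords_def)
  have "(\<integral>\<omega>. Z (\<phi>\<^sub>1, \<theta>\<^sub>1) \<omega> $ i * Z (\<phi>\<^sub>2, \<theta>\<^sub>2) \<omega> $ j \<partial>M) = cov_series \<phi>\<^sub>1 \<phi>\<^sub>2 (\<theta>\<^sub>1 - \<theta>\<^sub>2) $ i $ j" for i j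
  proof (rule LIMSEQ_unique)
    show "(\<lambda>N. \<integral>\<omega>. (\<Sum>n<N. harmonic n \<phi>\<^sub>1 \<theta>\<^sub>1 \<omega> $ i) * (\<Sum>n<N. harmonic n \<phi>\<^sub>2 \<theta>\<^sub>2 \<omega> $ j) \<partial>M)
        \<longlonglongrightarrow> (\<integral>\<omega>. Z (\<phi>\<^sub>1, \<theta>\<^sub>1) \<omega> $ i * Z (\<phi>\<^sub>2, \<theta>\<^sub>2) \<omega> $ j \<partial>M)"
      by (intro tendsto_integral_mult_mean_square square_integrable_sum square_integrable_vec_nth
          square_integrable_harmonic square_integrable_series_field
          mean_square_sums_vec_nth series_field_sums p \<phi>)
    show "(\<lambda>N. \<integral>\<omega>. (\<Sum>n<N. harmonic n \<phi>\<^sub>1 \<theta>\<^sub>1 \<omega> $ i) * (\<Sum>n<N. harmonic n \<phi>\<^sub>2 \<theta>\<^sub>2 \<omega> $ j) \<partial>M)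
        \<longlonglongrightarrow> cov_series \<phi>\<^sub>1 \<phi>\<^sub>2 (\<theta>\<^sub>1 - \<theta>\<^sub>2) $ i $ j"
      using cov_series_nth_sums[OF \<phi>] by (simp add: integral_sum_harmonic_mult[OF \<phi>] sums_def)
  qed
  then show "cov_mat M (Z (\<phi>\<^sub>1, \<theta>\<^sub>1)) (Z (\<phi>\<^sub>2, \<theta>\<^sub>2)) = cov_series \<phi>\<^sub>1 \<phi>\<^sub>2 (\<theta>\<^sub>1 - \<theta>\<^sub>2)"
    by (simp add: cov_mat_def vec_eq_iff integral_series_field p)
qed

text \<open>The cosine is even, so \<open>cov_series\<close> witnesses both axial symmetry and
  reversibility.\<close>

lemma longitudinally_reversible_series_field: "longitudinally_reversible M Z"
proof -
  have "second_order_process M sphere_coords Z"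
    unfolding second_order_process_iff using square_integrable_series_field by auto
  moreover have "\<exists>\<mu>. \<forall>(\<phi>, \<theta>)\<in>sphere_coords. integral\<^sup>L M (Z (\<phi>, \<theta>)) = \<mu> \<phi>"
    using integral_series_field by (intro exI[of _ "\<lambda>\<phi>. 0"]) auto
  moreover have "cov_series \<phi>\<^sub>1 \<phi>\<^sub>2 (- \<theta>) = cov_series \<phi>\<^sub>1 \<phi>\<^sub>2 \<theta>" for \<phi>\<^sub>1 \<phi>\<^sub>2 \<theta>
    by (simp add: cov_series_def)
  ultimately show ?thesis
    unfolding longitudinally_reversible_def axially_symmetric_def
    using axial_cov_fun_series_field by blast
qed

end

end

text \<open>The claims on mean and covariance quantify over all mean square sums \<open>Z\<close>,
  since these are unique only up to null sets at each point; existence is a separate conjunct. So is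
  summability, because an infinite sum has a value even when its series diverges.\<close>

theorem theorem4:
  fixes M :: "'w measure"
    and V :: "nat \<Rightarrow> nat \<Rightarrow> real \<Rightarrow> 'w \<Rightarrow> real ^ 'm"
    and B :: "nat \<Rightarrow> real \<Rightarrow> real \<Rightarrow> real ^ 'm ^ 'm"
  defines "C \<equiv> \<lambda>\<phi>\<^sub>1 \<phi>\<^sub>2 \<theta>. \<Sum>n. cos (real n * \<theta>) *\<^sub>R B n \<phi>\<^sub>1 \<phi>\<^sub>2"
  assumes "prob_space M"
    and "\<And>n k. k \<in> {1, 2} \<Longrightarrow> second_order_process M {0..pi} (V n k)"
    and "\<And>n k \<phi>. k \<in> {1, 2} \<Longrightarrow> \<phi> \<in> {0..pi} \<Longrightarrow> integral\<^sup>L M (V n k \<phi>) = 0"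
    and "\<And>n k \<phi>\<^sub>1 \<phi>\<^sub>2. k \<in> {1, 2} \<Longrightarrow> \<phi>\<^sub>1 \<in> {0..pi} \<Longrightarrow> \<phi>\<^sub>2 \<in> {0..pi} \<Longrightarrow>
           cov_mat M (V n k \<phi>\<^sub>1) (V n k \<phi>\<^sub>2) = B n \<phi>\<^sub>1 \<phi>\<^sub>2"
    and "\<And>n. indep_processes M {0..pi} (V n 1) (V n 2)"
    and "\<And>n n' k k'. n \<noteq> n' \<Longrightarrow> k \<in> {1, 2} \<Longrightarrow> k' \<in> {1, 2} \<Longrightarrow>
           indep_processes M {0..pi} (V n k) (V n' k')"
    and "\<And>\<phi>\<^sub>1 \<phi>\<^sub>2. \<phi>\<^sub>1 \<in> {0..pi} \<Longrightarrow> \<phi>\<^sub>2 \<in> {0..pi} \<Longrightarrow> summable (\<lambda>n. B n \<phi>\<^sub>1 \<phi>\<^sub>2)"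
  shows "(\<exists>Z. is_series_field M V Z) \<and>
         (\<forall>\<phi>\<^sub>1\<in>{0..pi}. \<forall>\<phi>\<^sub>2\<in>{0..pi}. \<forall>\<theta>\<in>{-2 * pi..2 * pi}.
            summable (\<lambda>n. cos (real n * \<theta>) *\<^sub>R B n \<phi>\<^sub>1 \<phi>\<^sub>2)) \<and>
         (\<forall>Z. is_series_field M V Z \<longrightarrow>
            longitudinally_reversible M Z \<and>
            (\<forall>x\<in>sphere_coords. integral\<^sup>L M (Z x) = 0) \<and>
            axial_cov_fun M Z C)"
proof -
  interpret prob_space M by fact
  interpret spectral_processes M V B
    by unfold_locales (use assms in \<open>auto simp: second_order_process_iff\<close>)
  have "C = cov_series"
    by (simp add: C_def cov_series_def[abs_def])
  then show ?thesis
    using ex_series_field summable_cos_B longitudinally_reversible_series_field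
      integral_series_field axial_cov_fun_series_field by auto
qed

end
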